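(* Let $k$ be a positive integer and $\epsilon \in [0,1)$. Define $$f(k,\epsilon) = \begin{cases} 2k & \text{if } \epsilon(2k+2) < 2, \\ \lceil (2k+2)(1-\epsilon) \rceil & \text{if } \epsilon \in [2/(2k+2), 1/2), \\ k+1 & \text{if } \epsilon \in [1/2, (k+2)/(2k+3)), \\ \lceil (2k+3)(1-\epsilon) \rceil & \text{if } \epsilon \geq (k+2)/(2k+3). \end{cases}$$ Then every $(k+\epsilon, 0)$-sparse graph $G$ admits a partition $E(G) = E(F)\cup E(G')$ (disjoint) where $F$ is a forest and $G'$ is $(k, 1-f(k,\epsilon))$-sparse.
   Context: All graphs are finite and simple. For a graph $H$, $v(H)$ and $e(H)$ denote its numbers of vertices and edges. For $a \in \mathbb{R}_{>0}$ and $b \in \mathbb{R}$, a graph $G$ is $(a,b)$-sparse if every nonempty subgraph $H$ of $G$ satisfies $e(H) \leq a\, v(H) + b$. *)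

theory Defs
  imports Complex_Main
begin

text \<open>A graph is a pair of a vertex set and a set of edges, each edge being a two-element
  set of vertices.\<close>

type_synonym 'a ugraph = "'a set \<times> 'a set set"

abbreviation uverts :: "'a ugraph \<Rightarrow> 'a set" where
  "uverts G \<equiv> fst G"

abbreviation uedges :: "'a ugraph \<Rightarrow> 'a set set" where
  "uedges G \<equiv> snd G"

definition finite_simple_graph :: "'a ugraph \<Rightarrow> bool" where
  "finite_simple_graph G \<longleftrightarrow>
     finite (uverts G) \<and> (\<forall>e\<in>uedges G. e \<subseteq> uverts G \<and> card e = 2)"

definition usubgraph :: "'a ugraph \<Rightarrow> 'a ugraph \<Rightarrow> bool" where
  "usubgraph H G \<longleftrightarrow>
     finite_simple_graph H \<and> uverts H \<subseteq> uverts G \<and> uedges H \<subseteq> uedges G"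

definition is_cycle :: "'a ugraph \<Rightarrow> 'a list \<Rightarrow> bool" where
  "is_cycle G p \<longleftrightarrow>
     3 \<le> length p \<and> distinct p \<and>
     (\<forall>i<length p. {p ! i, p ! (Suc i mod length p)} \<in> uedges G)"

definition forest :: "'a ugraph \<Rightarrow> bool" where
  "forest G \<longleftrightarrow> finite_simple_graph G \<and> (\<nexists>p. is_cycle G p)"

text \<open>A subgraph is nonempty if it has at least one edge. Admitting a single vertex as a
  nonempty subgraph would force \<open>0 \<le> a + b\<close>, so that no graph with a vertex could be
  \<open>(k, 1 - 2 * k)\<close>-sparse for \<open>k \<ge> 2\<close>.\<close>

definition sparse :: "real \<Rightarrow> real \<Rightarrow> 'a ugraph \<Rightarrow> bool" where
  "sparse a b G \<longleftrightarrow>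
     (\<forall>H. usubgraph H G \<and> uedges H \<noteq> {} \<longrightarrow>
        real (card (uedges H)) \<le> a * real (card (uverts H)) + b)"

text \<open>For \<open>k > 0\<close> and \<open>0 \<le> \<epsilon> < 1\<close> the four conditions are mutually exclusive and
  exhaustive, so each branch omits the lower bound on \<open>\<epsilon>\<close> implied by the failure of the
  preceding ones.\<close>

definition sparse_f :: "nat \<Rightarrow> real \<Rightarrow> int" where
  "sparse_f k \<epsilon> =
     (if \<epsilon> * (2 * real k + 2) < 2 then 2 * int k
      else if \<epsilon> < 1 / 2 then \<lceil>(2 * real k + 2) * (1 - \<epsilon>)\<rceil>
      else if \<epsilon> < (real k + 2) / (2 * real k + 3) then int k + 1
      else \<lceil>(2 * real k + 3) * (1 - \<epsilon>)\<rceil>)"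

end

theory Submission
  imports Defs "HOL-Library.Disjoint_Sets"
begin

text \<open>
  Put \<open>l = f(k, \<epsilon>) - 1\<close>. Both forests and \<open>(k, -l)\<close>-sparse edge sets are the independent sets of a
  matroid defined by an intersecting submodular function, \<open>|V(X)| - 1\<close> and \<open>k |V(X)| - l\<close>, so by
  matroid partition it suffices that \<open>|X|\<close> is at most the sum of the two ranks of \<open>X\<close>, for
  connected \<open>X\<close>. The second rank is attained by a family of disjoint blocks \<open>Q\<^sub>1, \<dots>, Q\<^sub>t\<close>, and the
  claim becomes that the excesses \<open>d\<^sub>i = |Q\<^sub>i| - k v\<^sub>i + l\<close>, where \<open>v\<^sub>i = |V(Q\<^sub>i)|\<close>, sum to less than the
  number \<open>v\<close> of vertices covered. A block with positive excess has \<open>v\<^sub>i \<ge> 2 k\<close> since the graph is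
  simple, and the choice of \<open>f\<close> gives \<open>d\<^sub>i < v\<^sub>i\<close>. If the overlap \<open>s = \<Sum> v\<^sub>i - v\<close> is less than \<open>t\<close>, summing
  these bounds suffices; otherwise the bound \<open>\<Sum> |Q\<^sub>i| \<le> (k + \<epsilon>) v\<close> does.
\<close>

section \<open>Matroids induced by intersecting submodular functions\<close>

lemma card_eq_blocks:
  fixes \<Q> :: "'e set set"
  assumes "finite A" "finite \<Q>" "disjoint \<Q>"
  shows "card A = card (A - \<Union>\<Q>) + (\<Sum>Q\<in>\<Q>. card (A \<inter> Q))"
proof -
  have "card A = card (A - \<Union>\<Q>) + card (A \<inter> \<Union>\<Q>)"
    using assms(1) by (metis add.commute card_Int_Diff)
  also have "A \<inter> \<Union>\<Q> = (\<Union>Q\<in>\<Q>. A \<inter> Q)" by blast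
  also have "card \<dots> = (\<Sum>Q\<in>\<Q>. card (A \<inter> Q))"
    using assms by (intro card_UN_disjoint) (auto simp: disjoint_def)
  finally show ?thesis .
qed

text \<open>The value \<open>f {}\<close> is left free, because \<open>count_bound c l {}\<close> is
  \<open>- l\<close>; hence submodularity is asked only of intersecting pairs and monotonicity only
  above nonempty sets. The bound on singletons rules out loops.\<close>

locale intersecting_submodular =
  fixes E :: "'e set" and f :: "'e set \<Rightarrow> int"
  assumes finite_ground: "finite E"
    and mono: "\<lbrakk>X \<noteq> {}; X \<subseteq> Y; Y \<subseteq> E\<rbrakk> \<Longrightarrow> f X \<le> f Y"
    and singleton_ge_1: "e \<in> E \<Longrightarrow> 1 \<le> f {e}"
    and submodular: "\<lbrakk>X \<subseteq> E; Y \<subseteq> E; X \<inter> Y \<noteq> {}\<rbrakk> \<Longrightarrow> f (X \<union> Y) + f (X \<inter> Y) \<le> f X + f Y"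
begin

definition indep :: "'e set \<Rightarrow> bool" where
  "indep A \<longleftrightarrow> A \<subseteq> E \<and> (\<forall>Y\<subseteq>A. Y \<noteq> {} \<longrightarrow> int (card Y) \<le> f Y)"

definition rank :: "'e set \<Rightarrow> nat" where
  "rank X = Max (card ` {A. A \<subseteq> X \<and> indep A})"

definition tight :: "'e set \<Rightarrow> 'e set \<Rightarrow> bool" where
  "tight A T \<longleftrightarrow> T \<subseteq> A \<and> T \<noteq> {} \<and> int (card T) = f T"

definition max_tight :: "'e set \<Rightarrow> 'e set \<Rightarrow> bool" where
  "max_tight A M \<longleftrightarrow> tight A M \<and> (\<forall>T. tight A T \<longrightarrow> M \<subseteq> T \<longrightarrow> T = M)"

text \<open>For \<open>M\<close> tight in an independent set, this is the matroid closure of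
  \<open>M\<close> within \<open>X\<close>.\<close>

definition span_in :: "'e set \<Rightarrow> 'e set \<Rightarrow> 'e set" where
  "span_in X M = {e \<in> X. f (insert e M) \<le> f M}"

lemma finite_subset_ground: "X \<subseteq> E \<Longrightarrow> finite X"
  using finite_ground finite_subset by blast

lemma indep_empty: "indep {}"
  by (simp add: indep_def)

lemma indep_subset: "indep A \<Longrightarrow> B \<subseteq> A \<Longrightarrow> indep B"
  unfolding indep_def by blast

lemma indep_ground: "indep A \<Longrightarrow> A \<subseteq> E"
  by (simp add: indep_def)

lemma indepD: "indep A \<Longrightarrow> Y \<subseteq> A \<Longrightarrow> Y \<noteq> {} \<Longrightarrow> int (card Y) \<le> f Y"
  unfolding indep_def by blast

lemma ge_1: "X \<noteq> {} \<Longrightarrow> X \<subseteq> E \<Longrightarrow> 1 \<le> f X"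
proof -
  assume X: "X \<noteq> {}" "X \<subseteq> E"
  then obtain e where e: "e \<in> X" by blast
  then have "f {e} \<le> f X" using X by (intro mono) auto
  with singleton_ge_1[of e] e X show ?thesis by fastforce
qed

text \<open>Uncrossing: \<open>card\<close> is modular and \<open>f\<close> submodular on the pair,
  while independence bounds \<open>card\<close> by \<open>f\<close> on union and intersection.
  Equality on \<open>S\<close> and \<open>T\<close> forces equality on both.\<close>

lemma tight_Un:
  assumes A: "indep A" and S: "tight A S" and T: "tight A T" and ne: "S \<inter> T \<noteq> {}"
  shows "tight A (S \<union> T)"
proof -
  have sub: "S \<subseteq> E" "T \<subseteq> E" "S \<subseteq> A" "T \<subseteq> A"
    using indep_ground[OF A] S T by (auto simp: tight_def)
  have "int (card (S \<union> T)) + int (card (S \<inter> T)) = int (card S) + int (card T)"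
    using card_Un_Int[of S T] sub finite_subset_ground by (metis of_nat_add)
  moreover have "int (card (S \<union> T)) \<le> f (S \<union> T)" "int (card (S \<inter> T)) \<le> f (S \<inter> T)"
    using sub ne by (auto intro!: indepD[OF A])
  moreover have "f (S \<union> T) + f (S \<inter> T) \<le> f S + f T"
    using submodular sub ne by blast
  ultimately show ?thesis
    using S T by (auto simp: tight_def)
qed

lemma ex_max_tight:
  assumes A: "indep A" and T: "tight A T"
  shows "\<exists>M. max_tight A M \<and> T \<subseteq> M"
proof -
  have fin: "finite {S. tight A S}"
    using finite_subset_ground[OF indep_ground[OF A]]
    by (auto simp: tight_def intro: finite_subset[of _ "Pow A"])
  then obtain M where "M \<in> {S. tight A S}" "T \<subseteq> M" "\<forall>S\<in>{S. tight A S}. M \<subseteq> S \<longrightarrow> M = S"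
    using finite_has_maximal2[OF fin] T by blast
  then show ?thesis by (auto simp: max_tight_def)
qed

lemma max_tight_disjoint:
  assumes A: "indep A" and M: "max_tight A M" and N: "max_tight A N" and ne: "M \<noteq> N"
  shows "M \<inter> N = {}"
proof (rule ccontr)
  assume "M \<inter> N \<noteq> {}"
  then have "tight A (M \<union> N)"
    using tight_Un A M N by (simp add: max_tight_def)
  then have "M \<union> N = M" "M \<union> N = N"
    using M N unfolding max_tight_def by blast+
  with ne show False by simp
qed

text \<open>A set violating independence of \<open>insert e A\<close> must contain \<open>e\<close>.
  Removing \<open>e\<close> lowers the cardinality by one and does not raise \<open>f\<close>, so
  the remaining set has no slack.\<close>

lemma ex_tight_spanning:
  assumes A: "indep A" and e: "e \<in> E" "e \<notin> A" and dep: "\<not> indep (insert e A)"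
  shows "\<exists>T. tight A T \<and> f (insert e T) \<le> f T"
proof -
  obtain Y where Y: "Y \<subseteq> insert e A" "Y \<noteq> {}" "f Y < int (card Y)"
    using A e(1) dep unfolding indep_def by (meson insert_subset not_le)
  have eY: "e \<in> Y"
  proof (rule ccontr)
    assume "e \<notin> Y"
    then have "Y \<subseteq> A" using Y(1) by blast
    from indepD[OF A this Y(2)] Y(3) show False by simp
  qed
  define T where "T = Y - {e}"
  have YT: "Y = insert e T" "e \<notin> T" "T \<subseteq> A" "finite T"
    using Y(1) eY indep_ground[OF A] finite_subset_ground[of T] by (auto simp: T_def)
  have c: "card Y = Suc (card T)" using YT by simp
  have ne: "T \<noteq> {}"
    using Y(3) c YT(1) singleton_ge_1[OF e(1)] by force
  have "int (card T) \<le> f T" by (rule indepD[OF A YT(3) ne])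
  moreover have "f T \<le> f Y" using YT indep_ground[OF A] e ne by (intro mono) auto
  ultimately show ?thesis
    using Y(3) c YT(1,3) ne by (intro exI[of _ T]) (simp add: tight_def)
qed

lemma span_Int_indep:
  assumes A: "indep A" "A \<subseteq> X" and M: "tight A M"
  shows "span_in X M \<inter> A = M"
proof
  show "M \<subseteq> span_in X M \<inter> A"
    using A M by (auto simp: span_in_def tight_def insert_absorb)
  show "span_in X M \<inter> A \<subseteq> M"
  proof (rule subsetI, rule ccontr)
    fix e assume e: "e \<in> span_in X M \<inter> A" "e \<notin> M"
    then have "int (card (insert e M)) \<le> f (insert e M)"
      using M by (intro indepD[OF A(1)]) (auto simp: tight_def)
    moreover have "finite M" using M finite_subset_ground indep_ground[OF A(1)] by (auto simp: tight_def)
    ultimately show False using e M by (auto simp: span_in_def tight_def)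
  qed
qed

text \<open>Elements are added one at a time: the current set and \<open>insert e M\<close>
  intersect in a superset of \<open>M\<close>, so submodularity and monotonicity keep the value at
  most \<open>f M\<close>.\<close>

lemma f_span:
  assumes A: "indep A" "A \<subseteq> X" "X \<subseteq> E" and M: "tight A M"
  shows "f (span_in X M) = f M"
proof -
  have ME: "M \<noteq> {}" "M \<subseteq> E" using M A by (auto simp: tight_def)
  have MS: "M \<subseteq> span_in X M" using span_Int_indep[OF A(1,2) M] by blast
  have SE: "span_in X M \<subseteq> E" using A by (auto simp: span_in_def)
  have *: "f (M \<union> S) \<le> f M" if "finite S" "S \<subseteq> span_in X M" for S
    using that
  proof (induction S)
    case (insert e S)
    have "f ((M \<union> S) \<union> insert e M) + f ((M \<union> S) \<inter> insert e M) \<le> f (M \<union> S) + f (insert e M)"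
      using ME SE insert.prems by (intro submodular) auto
    moreover have "f M \<le> f ((M \<union> S) \<inter> insert e M)"
      using ME SE insert.prems by (intro mono) auto
    moreover have "f (insert e M) \<le> f M" using insert.prems by (simp add: span_in_def)
    moreover have "(M \<union> S) \<union> insert e M = M \<union> insert e S" by auto
    ultimately show ?case using insert by simp
  qed simp
  have "f (span_in X M) \<le> f M"
    using *[of "span_in X M"] MS SE finite_subset_ground by (simp add: sup.absorb2)
  moreover have "f M \<le> f (span_in X M)" using ME MS SE by (rule_tac mono) auto
  ultimately show ?thesis by simp
qed

text \<open>A common element \<open>e\<close> lies outside \<open>A\<close>, so
  \<open>insert e M\<close> and \<open>insert e N\<close> meet in \<open>{e}\<close> only. As
  \<open>f {e} \<ge> 1\<close>, submodularity pushes \<open>f (M \<union> N)\<close> below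
  \<open>card (M \<union> N)\<close>, against independence.\<close>

lemma span_disjoint:
  assumes A: "indep A" "A \<subseteq> X" "X \<subseteq> E" and M: "max_tight A M" and N: "max_tight A N"
    and ne: "M \<noteq> N"
  shows "span_in X M \<inter> span_in X N = {}"
proof (rule ccontr)
  have dis: "M \<inter> N = {}" by (rule max_tight_disjoint[OF A(1) M N ne])
  have t: "tight A M" "tight A N" using M N by (auto simp: max_tight_def)
  have sub: "M \<subseteq> A" "N \<subseteq> A" "M \<subseteq> E" "N \<subseteq> E" "M \<noteq> {}" "N \<noteq> {}"
    using t A by (auto simp: tight_def)
  assume "span_in X M \<inter> span_in X N \<noteq> {}"
  then obtain e where e: "e \<in> span_in X M" "e \<in> span_in X N" by blast
  have eE: "e \<in> E" using e A by (auto simp: span_in_def)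
  have eA: "e \<notin> A"
    using e span_Int_indep[OF A(1,2) t(1)] span_Int_indep[OF A(1,2) t(2)] dis by blast
  have "f (insert e M \<union> insert e N) + f (insert e M \<inter> insert e N) \<le> f (insert e M) + f (insert e N)"
    using eE sub by (intro submodular) auto
  moreover have "insert e M \<inter> insert e N = {e}" using dis by auto
  then have "f (insert e M \<inter> insert e N) = f {e}" by (rule arg_cong)
  moreover have "f (insert e M) \<le> f M" "f (insert e N) \<le> f N" using e by (auto simp: span_in_def)
  moreover have "f (M \<union> N) \<le> f (insert e M \<union> insert e N)" using sub eE by (intro mono) auto
  moreover have "int (card (M \<union> N)) \<le> f (M \<union> N)" using sub by (intro indepD[OF A(1)]) auto
  moreover have "card (M \<union> N) = card M + card N"
    using dis sub finite_subset_ground by (intro card_Un_disjoint) auto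
  moreover have "int (card M) = f M" "int (card N) = f N" using t by (auto simp: tight_def)
  ultimately show False using singleton_ge_1[OF eE] by linarith
qed

text \<open>The blocks are the spans of the maximal tight subsets of \<open>A\<close>. A span meets
  \<open>A\<close> in its tight set, whose size is the value of \<open>f\<close> on the span, and
  every element of \<open>X - A\<close> lies in a span, so the count is exact.\<close>

lemma maximal_indep_blocks:
  assumes A: "indep A" "A \<subseteq> X" "X \<subseteq> E" and max: "\<And>e. e \<in> X - A \<Longrightarrow> \<not> indep (insert e A)"
  shows "\<exists>\<Q>. finite \<Q> \<and> disjoint \<Q> \<and> (\<forall>Q\<in>\<Q>. Q \<noteq> {} \<and> Q \<subseteq> X) \<and>
    int (card A) = int (card (X - \<Union>\<Q>)) + (\<Sum>Q\<in>\<Q>. f Q)"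
proof -
  define \<M> where "\<M> = {M. max_tight A M}"
  have M: "tight A M" "M \<subseteq> A" "M \<noteq> {}" "int (card M) = f M" if "M \<in> \<M>" for M
    using that by (auto simp: \<M>_def max_tight_def tight_def)
  have finA: "finite A" using A finite_subset_ground by blast
  have fin: "finite \<M>" using M(2) finA by (meson PowI finite_Pow_iff finite_subset subsetI)
  have spanA: "span_in X M \<inter> A = M" if "M \<in> \<M>" for M
    using span_Int_indep[OF A(1,2) M(1)[OF that]] .
  have disM: "disjoint \<M>"
    unfolding disjoint_def \<M>_def using max_tight_disjoint[OF A(1)] by blast
  have inj: "inj_on (span_in X) \<M>" using spanA by (metis inj_onI)
  have disQ: "disjoint (span_in X ` \<M>)"
    unfolding disjoint_def \<M>_def using span_disjoint[OF A] by blast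
  have cover: "\<exists>M\<in>\<M>. e \<in> span_in X M" if e: "e \<in> X - A" for e
  proof -
    obtain T where T: "tight A T" "f (insert e T) \<le> f T"
      using ex_tight_spanning[OF A(1) _ _ max[OF e]] e A by blast
    obtain N where N: "max_tight A N" "T \<subseteq> N" using ex_max_tight[OF A(1) T(1)] by blast
    have "T \<noteq> {}" "N \<subseteq> A"
      using T N by (auto simp: tight_def max_tight_def)
    then have sub: "T \<noteq> {}" "T \<subseteq> E" "N \<subseteq> A" "N \<subseteq> E" "e \<in> E"
      using N(2) A e by auto
    \<comment> \<open>Submodularity carries the spanning of \<open>e\<close> over from
      \<open>T\<close> to the maximal tight set \<open>N\<close>.\<close>
    have "f (insert e T \<union> N) + f (insert e T \<inter> N) \<le> f (insert e T) + f N"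
      using sub N by (intro submodular) auto
    moreover have "insert e T \<inter> N = T" "insert e T \<union> N = insert e N" using e sub N by auto
    ultimately show ?thesis using T N e by (auto simp: \<M>_def span_in_def)
  qed
  have rest: "X - \<Union>(span_in X ` \<M>) = A - \<Union>\<M>"
  proof (rule set_eqI)
    fix e
    show "e \<in> X - \<Union>(span_in X ` \<M>) \<longleftrightarrow> e \<in> A - \<Union>\<M>"
      using cover[of e] spanA A(2) M(2) by (cases "e \<in> A") blast+
  qed
  have "int (card A) = int (card (A - \<Union>\<M>)) + (\<Sum>M\<in>\<M>. int (card (A \<inter> M)))"
    using card_eq_blocks[OF finA fin disM] by simp
  also have "(\<Sum>M\<in>\<M>. int (card (A \<inter> M))) = (\<Sum>M\<in>\<M>. f (span_in X M))"
    using M by (intro sum.cong refl) (simp add: f_span[OF A] Int_absorb1)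
  also have "\<dots> = (\<Sum>Q\<in>span_in X ` \<M>. f Q)" using inj by (simp add: sum.reindex)
  finally have eq: "int (card A) = int (card (X - \<Union>(span_in X ` \<M>))) + (\<Sum>Q\<in>span_in X ` \<M>. f Q)"
    using rest by simp
  have "\<forall>Q\<in>span_in X ` \<M>. Q \<noteq> {} \<and> Q \<subseteq> X"
    using spanA M(3) by (fastforce simp: span_in_def)
  with eq fin disQ show ?thesis by (intro exI[of _ "span_in X ` \<M>"]) auto
qed

lemma indep_card_le_blocks:
  assumes A: "indep A" "A \<subseteq> X" "X \<subseteq> E"
    and Q: "finite \<Q>" "disjoint \<Q>" "\<forall>Q\<in>\<Q>. Q \<noteq> {} \<and> Q \<subseteq> X"
  shows "int (card A) \<le> int (card (X - \<Union>\<Q>)) + (\<Sum>Q\<in>\<Q>. f Q)"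
proof -
  have fin: "finite A" "finite X" using A finite_subset_ground by auto
  have "int (card A) = int (card (A - \<Union>\<Q>)) + (\<Sum>Q\<in>\<Q>. int (card (A \<inter> Q)))"
    using card_eq_blocks[OF fin(1) Q(1,2)] by simp
  moreover have "card (A - \<Union>\<Q>) \<le> card (X - \<Union>\<Q>)" using A fin by (intro card_mono) auto
  moreover have "int (card (A \<inter> Q)) \<le> f Q" if "Q \<in> \<Q>" for Q
  proof (cases "A \<inter> Q = {}")
    case True
    \<comment> \<open>Monotonicity says nothing about \<open>f {}\<close>, so a block missing
      \<open>A\<close> needs \<open>f Q \<ge> 1\<close> instead.\<close>
    then show ?thesis using ge_1[of Q] that Q(3) A(3) by fastforce
  next
    case False
    have "int (card (A \<inter> Q)) \<le> f (A \<inter> Q)" using False by (intro indepD[OF A(1)]) auto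
    also have "\<dots> \<le> f Q" using False that Q A by (intro mono) auto
    finally show ?thesis .
  qed
  ultimately show ?thesis
    using sum_mono[of \<Q> "\<lambda>Q. int (card (A \<inter> Q))" f] by fastforce
qed

lemma finite_indeps: "X \<subseteq> E \<Longrightarrow> finite {A. A \<subseteq> X \<and> indep A}"
  using finite_subset_ground by (auto intro: finite_subset[of _ "Pow X"])

lemma indep_card_le_rank: "indep A \<Longrightarrow> A \<subseteq> X \<Longrightarrow> X \<subseteq> E \<Longrightarrow> card A \<le> rank X"
  unfolding rank_def using finite_indeps by (intro Max_ge) auto

lemma rank_witness:
  assumes "X \<subseteq> E"
  shows "\<exists>A. A \<subseteq> X \<and> indep A \<and> card A = rank X"
proof -
  have "rank X \<in> card ` {A. A \<subseteq> X \<and> indep A}"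
    unfolding rank_def using finite_indeps[OF assms] indep_empty by (intro Max_in) auto
  then show ?thesis by auto
qed

lemma rank_le_card: "X \<subseteq> E \<Longrightarrow> rank X \<le> card X"
  using rank_witness[of X] finite_subset_ground by (metis card_mono)

lemma indep_if_rank_eq_card: "X \<subseteq> E \<Longrightarrow> rank X = card X \<Longrightarrow> indep X"
  using rank_witness[of X] finite_subset_ground by (metis card_subset_eq)

lemma ex_maximal_indep:
  assumes X: "X \<subseteq> E" and I: "indep I" "I \<subseteq> X"
  shows "\<exists>A. indep A \<and> I \<subseteq> A \<and> A \<subseteq> X \<and> (\<forall>e\<in>X - A. \<not> indep (insert e A))"
proof -
  obtain A where A: "A \<subseteq> X" "indep A" "I \<subseteq> A" "\<forall>B\<in>{A. A \<subseteq> X \<and> indep A}. A \<subseteq> B \<longrightarrow> A = B"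
    using finite_has_maximal2[OF finite_indeps[OF X], of I] I by auto
  have "\<not> indep (insert e A)" if "e \<in> X - A" for e
    using A(1) A(4)[rule_format, of "insert e A"] that by auto
  with A show ?thesis by blast
qed

text \<open>The blocks obtained from \<open>A\<close> bound every independent subset of
  \<open>X\<close> by \<open>card A\<close>. This takes the place of the exchange axiom.\<close>

lemma maximal_indep_card:
  assumes "indep A" "A \<subseteq> X" "X \<subseteq> E" "\<forall>e\<in>X - A. \<not> indep (insert e A)"
  shows "card A = rank X"
proof -
  obtain \<Q> where Q: "finite \<Q>" "disjoint \<Q>" "\<forall>Q\<in>\<Q>. Q \<noteq> {} \<and> Q \<subseteq> X"
    "int (card A) = int (card (X - \<Union>\<Q>)) + (\<Sum>Q\<in>\<Q>. f Q)"
    using maximal_indep_blocks[OF assms(1-3)] assms(4) by blast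
  obtain B where B: "B \<subseteq> X" "indep B" "card B = rank X" using rank_witness[OF assms(3)] by blast
  have "int (card B) \<le> int (card A)"
    using indep_card_le_blocks[OF B(2,1) assms(3) Q(1-3)] Q(4) by simp
  with B indep_card_le_rank[OF assms(1-3)] show ?thesis by simp
qed

theorem rank_blocks:
  assumes "X \<subseteq> E"
  shows "\<exists>\<Q>. finite \<Q> \<and> disjoint \<Q> \<and> (\<forall>Q\<in>\<Q>. Q \<noteq> {} \<and> Q \<subseteq> X) \<and>
    int (rank X) = int (card (X - \<Union>\<Q>)) + (\<Sum>Q\<in>\<Q>. f Q)"
proof -
  obtain A where A: "indep A" "A \<subseteq> X" "\<forall>e\<in>X - A. \<not> indep (insert e A)"
    using ex_maximal_indep[OF assms indep_empty] by auto
  have "card A = rank X" by (rule maximal_indep_card[OF A(1,2) assms A(3)])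
  with maximal_indep_blocks[OF A(1,2) assms] A(3) show ?thesis by simp
qed

text \<open>A largest independent subset \<open>I\<close> of the intersection extends to a maximal
  one \<open>J\<close> of the union; counting \<open>J\<close> inside \<open>X\<close> and inside
  \<open>Y\<close> counts \<open>I\<close> twice.\<close>

theorem rank_submodular:
  assumes X: "X \<subseteq> E" and Y: "Y \<subseteq> E"
  shows "rank (X \<union> Y) + rank (X \<inter> Y) \<le> rank X + rank Y"
proof -
  obtain I where I: "I \<subseteq> X \<inter> Y" "indep I" "card I = rank (X \<inter> Y)"
    using rank_witness[of "X \<inter> Y"] X by blast
  obtain J where J: "indep J" "I \<subseteq> J" "J \<subseteq> X \<union> Y" "\<forall>e\<in>X \<union> Y - J. \<not> indep (insert e J)"
    using ex_maximal_indep[of "X \<union> Y" I] I X Y by blast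
  have rJ: "card J = rank (X \<union> Y)" using J X Y by (intro maximal_indep_card) auto
  have finJ: "finite J" using J X Y finite_subset_ground by (meson Un_least subset_trans)
  have "card (J \<inter> X) + card (J \<inter> Y) = card (J \<inter> X \<union> J \<inter> Y) + card (J \<inter> X \<inter> (J \<inter> Y))"
    using finJ by (intro card_Un_Int) auto
  also have "J \<inter> X \<union> J \<inter> Y = J" using J by blast
  finally have "card (J \<inter> X) + card (J \<inter> Y) = card J + card (J \<inter> X \<inter> (J \<inter> Y))" .
  moreover have "card I \<le> card (J \<inter> X \<inter> (J \<inter> Y))" using I J finJ by (intro card_mono) auto
  moreover have "card (J \<inter> X) \<le> rank X" "card (J \<inter> Y) \<le> rank Y"
    using J X Y by (auto intro!: indep_card_le_rank intro: indep_subset)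
  ultimately show ?thesis using rJ I by linarith
qed

end

section \<open>Matroid partition\<close>

text \<open>An element \<open>e\<close> that can join neither \<open>A\<close> nor \<open>B\<close> has two obstructing sets; uncrossing them
  contradicts the rank condition on their union with \<open>e\<close> and on their intersection.\<close>

lemma matroid_partition_extend:
  fixes r1 r2 :: "'e set \<Rightarrow> nat"
  assumes sub1: "\<And>X Y. X \<subseteq> E \<Longrightarrow> Y \<subseteq> E \<Longrightarrow> r1 (X \<union> Y) + r1 (X \<inter> Y) \<le> r1 X + r1 Y"
    and sub2: "\<And>X Y. X \<subseteq> E \<Longrightarrow> Y \<subseteq> E \<Longrightarrow> r2 (X \<union> Y) + r2 (X \<inter> Y) \<le> r2 X + r2 Y"
    and "finite R"
    and "finite A" "finite B" "A \<union> B \<union> R \<subseteq> E" "A \<inter> B = {}" "A \<inter> R = {}" "B \<inter> R = {}"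
    and "\<And>X. X \<subseteq> R \<Longrightarrow> card X + card A + card B \<le> r1 (A \<union> X) + r2 (B \<union> X)"
  shows "\<exists>A' B'. A' \<union> B' = A \<union> B \<union> R \<and> A' \<inter> B' = {} \<and> card A' + card B' \<le> r1 A' + r2 B'"
  using assms(3-)
\<comment> \<open>\<open>R\<close> holds the elements not yet assigned. The last premise is the
  invariant under which each of them is placed in \<open>A\<close> or \<open>B\<close>; at
  \<open>R = {}\<close> it is the claim.\<close>
proof (induction R arbitrary: A B rule: finite_induct)
  case empty
  from empty.prems(7)[of "{}"] empty.prems(4) show ?case by (intro exI[of _ A] exI[of _ B]) simp
next
  case (insert e R)
  note prems = insert.prems
  have e: "e \<notin> A" "e \<notin> B" "e \<notin> R" using prems(5,6) insert.hyps by auto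
  let ?n = "card A + card B"
  have fin: "finite X" if "X \<subseteq> R" for X using that insert.hyps(1) finite_subset by blast
  show ?case
  proof (cases "\<forall>X\<subseteq>R. card X + card (insert e A) + card B \<le> r1 (insert e A \<union> X) + r2 (B \<union> X)")
    case True
    have "\<exists>A' B'. A' \<union> B' = insert e A \<union> B \<union> R \<and> A' \<inter> B' = {} \<and> card A' + card B' \<le> r1 A' + r2 B'"
      using True prems(1-6) e by (intro insert.IH) auto
    then show ?thesis by simp
  next
    case False
    then obtain X where X: "X \<subseteq> R" "r1 (insert e A \<union> X) + r2 (B \<union> X) \<le> card X + ?n"
      using e(1) prems(1) by (auto simp: not_le)
    have "card Y + card A + card (insert e B) \<le> r1 (A \<union> Y) + r2 (insert e B \<union> Y)" if Y: "Y \<subseteq> R" for Y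
    proof (rule ccontr)
      assume "\<not> ?thesis"
      then have Y': "r1 (A \<union> Y) + r2 (insert e B \<union> Y) \<le> card Y + ?n"
        using e(2) prems(2) by simp
      have XYE: "insert e A \<union> X \<subseteq> E" "A \<union> Y \<subseteq> E" "insert e B \<union> Y \<subseteq> E" "B \<union> X \<subseteq> E"
        using X(1) Y prems(3) by auto
      have i: "(insert e A \<union> X) \<inter> (A \<union> Y) = A \<union> (X \<inter> Y)"
        "(B \<union> X) \<inter> (insert e B \<union> Y) = B \<union> (X \<inter> Y)"
        "(insert e A \<union> X) \<union> (A \<union> Y) = A \<union> insert e (X \<union> Y)"
        "(B \<union> X) \<union> (insert e B \<union> Y) = B \<union> insert e (X \<union> Y)"
        using e X(1) Y prems(5,6) by auto
      have "r1 (A \<union> insert e (X \<union> Y)) + r1 (A \<union> (X \<inter> Y)) \<le> r1 (insert e A \<union> X) + r1 (A \<union> Y)"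
        using sub1[OF XYE(1,2)] i by simp
      moreover have "r2 (B \<union> insert e (X \<union> Y)) + r2 (B \<union> (X \<inter> Y)) \<le> r2 (B \<union> X) + r2 (insert e B \<union> Y)"
        using sub2[OF XYE(4,3)] i by simp
      moreover have "card (insert e (X \<union> Y)) + card A + card B
          \<le> r1 (A \<union> insert e (X \<union> Y)) + r2 (B \<union> insert e (X \<union> Y))"
        using X(1) Y by (intro prems(7)) auto
      moreover have "card (X \<inter> Y) + card A + card B \<le> r1 (A \<union> (X \<inter> Y)) + r2 (B \<union> (X \<inter> Y))"
        using X(1) Y by (intro prems(7)) auto
      \<comment> \<open>The element \<open>e\<close> is counted on the union side only; this surplus
        of one gives the contradiction.\<close>
      moreover have "card (insert e (X \<union> Y)) = Suc (card (X \<union> Y))"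
        using e(3) X(1) Y fin by (subst card_insert_disjoint) auto
      moreover have "card X + card Y = card (X \<union> Y) + card (X \<inter> Y)"
        using X(1) Y fin by (intro card_Un_Int) auto
      ultimately show False using X(2) Y' by linarith
    qed
    then have "\<exists>A' B'. A' \<union> B' = A \<union> insert e B \<union> R \<and> A' \<inter> B' = {} \<and> card A' + card B' \<le> r1 A' + r2 B'"
      using prems(1-6) e by (intro insert.IH) auto
    then show ?thesis by simp
  qed
qed

theorem matroid_partition:
  assumes M1: "intersecting_submodular E f1" and M2: "intersecting_submodular E f2"
    and le: "\<And>X. X \<subseteq> E \<Longrightarrow> card X \<le> intersecting_submodular.rank E f1 X +
      intersecting_submodular.rank E f2 X"
  shows "\<exists>A B. A \<union> B = E \<and> A \<inter> B = {} \<and>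
    intersecting_submodular.indep E f1 A \<and> intersecting_submodular.indep E f2 B"
proof -
  interpret M1: intersecting_submodular E f1 by (rule M1)
  interpret M2: intersecting_submodular E f2 by (rule M2)
  have "\<exists>A B. A \<union> B = {} \<union> {} \<union> E \<and> A \<inter> B = {} \<and> card A + card B \<le> M1.rank A + M2.rank B"
    using M1.finite_ground le M1.rank_submodular M2.rank_submodular
    by (intro matroid_partition_extend[where E = E]) auto
  then obtain A B where AB: "A \<union> B = E" "A \<inter> B = {}" "card A + card B \<le> M1.rank A + M2.rank B"
    by auto
  then have "M1.rank A = card A" "M2.rank B = card B"
    using M1.rank_le_card[of A] M2.rank_le_card[of B] by auto
  then show ?thesis
    using AB M1.indep_if_rank_eq_card M2.indep_if_rank_eq_card by blast
qed

section \<open>Count matroids on edge sets\<close>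

text \<open>The vertices of an edge set are those it covers, \<open>\<Union>X\<close>. Parameters
  \<open>1\<close> and \<open>1\<close> give the graphic matroid, \<open>k\<close> and
  \<open>l\<close> the \<open>(k, -l)\<close>-sparse sets.\<close>

definition count_bound :: "int \<Rightarrow> int \<Rightarrow> 'a set set \<Rightarrow> int" where
  "count_bound c l X = c * int (card (\<Union>X)) - l"

text \<open>Covered vertices are counted submodularly since \<open>\<Union>(X \<inter> Y)\<close>
  lies in \<open>\<Union>X \<inter> \<Union>Y\<close>, and the constant \<open>l\<close> cancels. A
  single edge has bound \<open>2 * c - l\<close>, which is where \<open>l < 2 * c\<close>
  enters.\<close>

lemma count_bound_submodular:
  assumes fin: "finite E" and two: "\<And>e. e \<in> E \<Longrightarrow> card e = 2" and l: "l < 2 * c" and c: "0 \<le> c"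
  shows "intersecting_submodular E (count_bound c l)"
proof
  have fU: "finite (\<Union>X)" if "X \<subseteq> E" for X
  proof (intro finite_Union)
    show "finite X" using that fin finite_subset by blast
    show "finite e" if "e \<in> X" for e
      using two[of e] that \<open>X \<subseteq> E\<close> card.infinite by fastforce
  qed
  show "finite E" by (rule fin)
  show "count_bound c l X \<le> count_bound c l Y" if "X \<subseteq> Y" "Y \<subseteq> E" for X Y
    using card_mono[OF fU[OF that(2)] Union_mono[OF that(1)]]
    by (simp add: count_bound_def mult_left_mono c)
  show "1 \<le> count_bound c l {e}" if "e \<in> E" for e
    using two[OF that] l by (simp add: count_bound_def)
  show "count_bound c l (X \<union> Y) + count_bound c l (X \<inter> Y) \<le> count_bound c l X + count_bound c l Y"
    if "X \<subseteq> E" "Y \<subseteq> E" for X Y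
  proof -
    have "card (\<Union>(X \<inter> Y)) \<le> card (\<Union>X \<inter> \<Union>Y)"
      using fU that by (intro card_mono) auto
    moreover have "card (\<Union>X) + card (\<Union>Y) = card (\<Union>(X \<union> Y)) + card (\<Union>X \<inter> \<Union>Y)"
      using card_Un_Int[OF fU[OF that(1)] fU[OF that(2)]] by simp
    ultimately have "card (\<Union>(X \<union> Y)) + card (\<Union>(X \<inter> Y)) \<le> card (\<Union>X) + card (\<Union>Y)" by simp
    then have "c * int (card (\<Union>(X \<union> Y)) + card (\<Union>(X \<inter> Y)))
        \<le> c * int (card (\<Union>X) + card (\<Union>Y))"
      using c by (intro mult_left_mono) auto
    then show ?thesis by (simp add: count_bound_def algebra_simps)
  qed
qed

section \<open>Arithmetic of block excesses\<close>

text \<open>The convex function \<open>v * (v - 1) / 2 - k * v\<close> equals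
  \<open>1 - 2 * k\<close> at both \<open>v = 2\<close> and \<open>v = 2 * k - 1\<close>. Between
  these points the excess is at most \<open>l + 1 - 2 * k\<close>, which is not positive.\<close>

lemma excess_vertices:
  fixes k v q l :: int
  assumes l: "l < 2 * k" and v: "2 \<le> v" and q: "2 * q \<le> v * (v - 1)"
    and excess: "1 \<le> q - k * v + l"
  shows "2 * k \<le> v"
proof (rule ccontr)
  assume "\<not> ?thesis"
  then have "0 \<le> (v - 2) * (2 * k - 1 - v)" using v by (intro mult_nonneg_nonneg) auto
  then show False using q excess l by (auto simp: algebra_simps)
qed

text \<open>Simplicity is enough up to \<open>2 * k + 1\<close> vertices, and sparsity from
  \<open>2 * k + 3\<close> on. At \<open>2 * k + 2\<close> vertices simplicity is enough if
  \<open>l \<le> k\<close>, and sparsity is used otherwise; the two thresholds are the factors in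
  \<open>sparse_f\<close>.\<close>

lemma excess_le_vertices:
  fixes k v q l :: int and \<epsilon> :: real
  assumes l: "l < 2 * k" and v: "2 \<le> v" and q: "2 * q \<le> v * (v - 1)"
    and excess: "1 \<le> q - k * v + l"
    and sparse: "real_of_int q \<le> (real_of_int k + \<epsilon>) * real_of_int v"
    and e: "\<epsilon> < 1"
    and l1: "real_of_int l < (2 * real_of_int k + 3) * (1 - \<epsilon>)"
    and l2: "k < l \<Longrightarrow> real_of_int l < (2 * real_of_int k + 2) * (1 - \<epsilon>)"
  shows "q - k * v + l \<le> v - 1"
proof -
  have v2k: "2 * k \<le> v" by (rule excess_vertices[OF l v q excess])
  \<comment> \<open>Sparsity bounds the excess by \<open>\<epsilon> * v + l\<close>.\<close>
  have large: ?thesis if "real_of_int l < real_of_int v * (1 - \<epsilon>)"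
  proof -
    have "real_of_int (q - k * v + l) < real_of_int v"
      using that sparse by (simp add: algebra_simps)
    then show ?thesis by linarith
  qed
  show ?thesis
  proof (cases "v \<le> 2 * k + 1")
    case True
    then have "v * (v - 1) \<le> v * (2 * k)" using v by (intro mult_left_mono) auto
    then have "q - k * v \<le> 0" using q by (simp add: algebra_simps)
    then show ?thesis using l v2k by linarith
  next
    case False
    show ?thesis
    proof (cases "k < l \<or> 2 * k + 3 \<le> v")
      case True
      then have "real_of_int l < real_of_int v * (1 - \<epsilon>)"
      proof
        assume "k < l"
        have "(2 * real_of_int k + 2) * (1 - \<epsilon>) \<le> real_of_int v * (1 - \<epsilon>)"
          using False e by (intro mult_right_mono) auto
        with l2[OF \<open>k < l\<close>] show ?thesis by simp
      next
        assume "2 * k + 3 \<le> v"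
        then have "(2 * real_of_int k + 3) * (1 - \<epsilon>) \<le> real_of_int v * (1 - \<epsilon>)"
          using e by (intro mult_right_mono) auto
        with l1 show ?thesis by simp
      qed
      then show ?thesis by (rule large)
    next
      case False': False
      with False have "v = 2 * k + 2" by simp
      \<comment> \<open>The complete graph on \<open>2 * k + 2\<close> vertices has
        \<open>k + 1\<close> edges more than \<open>k * v\<close>, so \<open>l \<le> k\<close>
        leaves an excess of at most \<open>2 * k + 1\<close>.\<close>
      then have "q - k * v \<le> k + 1" using q by (simp add: algebra_simps)
      with False' \<open>v = 2 * k + 2\<close> show ?thesis by simp
    qed
  qed
qed

text \<open>Here \<open>t\<close> blocks with \<open>v + s\<close> vertices in total, counted with multiplicity, cover \<open>v\<close> vertices,
  so \<open>s\<close> measures their overlap.\<close>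

lemma overlap_bound:
  fixes k l s t v :: real
  assumes k: "1 \<le> k" and l0: "0 \<le> l" and l: "l \<le> 2 * k - 1" and t: "0 < t" and st: "t \<le> s" and v: "0 < v"
    and vs: "2 * k * t \<le> v + s" and e: "\<epsilon> < 1"
    and l2: "k < l \<Longrightarrow> l < (2 * k + 2) * (1 - \<epsilon>)" and k2: "k < l \<Longrightarrow> 2 \<le> k"
  shows "t * l < (1 - \<epsilon>) * v + k * s"
proof (cases "k < l")
  case False
  then have "t * l \<le> s * k" using st t l0 by (intro mult_mono) auto
  moreover have "0 < (1 - \<epsilon>) * v" using e v by simp
  ultimately show ?thesis by (simp add: algebra_simps)
next
  case True
  \<comment> \<open>Scaling by \<open>2 * k + 2\<close> lets \<open>vs\<close> bound
    \<open>2 * k * t - s\<close> by \<open>v\<close>, whose factor \<open>l\<close> is then absorbed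
    by \<open>l2\<close>. The remaining \<open>2 * t + s\<close> is at most
    \<open>(k + 1) * s\<close>, because \<open>k \<ge> 2\<close> and
    \<open>t \<le> s\<close>.\<close>
  have "(2 * k + 2) * (t * l) = l * (2 * k * t - s) + l * (2 * t + s)" by (simp add: algebra_simps)
  also have "\<dots> \<le> l * v + l * (2 * t + s)" using vs l0 by (intro add_right_mono mult_left_mono) auto
  also have "l * (2 * t + s) \<le> l * (k * s + s)"
  proof (intro mult_left_mono add_right_mono)
    show "2 * t \<le> k * s" using k2[OF True] st t by (intro mult_mono) auto
  qed (rule l0)
  also have "l * (k * s + s) \<le> 2 * k * (k * s + s)" using l k st t by (intro mult_right_mono) auto
  also have "l * v < (2 * k + 2) * (1 - \<epsilon>) * v" using l2[OF True] v by (intro mult_strict_right_mono) auto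
  finally have "(2 * k + 2) * (t * l) < (2 * k + 2) * ((1 - \<epsilon>) * v + k * s)" by (simp add: algebra_simps)
  then show ?thesis using k by simp
qed

lemma card_edges_le:
  assumes "finite X" "\<And>e. e \<in> X \<Longrightarrow> card e = 2" "finite (\<Union>X)"
  shows "2 * int (card X) \<le> int (card (\<Union>X)) * (int (card (\<Union>X)) - 1)"
proof -
  have "card X \<le> card {e. e \<subseteq> \<Union>X \<and> card e = 2}"
    using assms by (intro card_mono) auto
  also have "\<dots> = card (\<Union>X) choose 2" by (rule n_subsets[OF assms(3)])
  also have "\<dots> = card (\<Union>X) * (card (\<Union>X) - 1) div 2" by (rule choose_two)
  finally have "2 * card X \<le> card (\<Union>X) * (card (\<Union>X) - 1)" by simp
  then have "int (2 * card X) \<le> int (card (\<Union>X) * (card (\<Union>X) - 1))" by (rule of_nat_mono)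
  then show ?thesis by (cases "card (\<Union>X)") (auto simp: algebra_simps)
qed

text \<open>These inequalities are all that the proof takes from \<open>sparse_f\<close>. A ceiling
  minus one stays strictly below its argument, and in the last two branches
  \<open>l \<le> k\<close>, so the final claim is vacuous there.\<close>

lemma sparse_f_bounds:
  assumes k: "k > 0" and e: "0 \<le> \<epsilon>" "\<epsilon> < 1"
  defines "l \<equiv> sparse_f k \<epsilon> - 1"
  shows "0 \<le> l" "l < 2 * int k" "real_of_int l < (2 * real k + 3) * (1 - \<epsilon>)"
    "int k < l \<Longrightarrow> real_of_int l < (2 * real k + 2) * (1 - \<epsilon>)"
proof -
  have A: "\<epsilon> < (real k + 2) / (2 * real k + 3) \<longleftrightarrow> \<epsilon> * (2 * real k + 3) < real k + 2"
    by (simp add: field_simps)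
  have c: "real_of_int \<lceil>x\<rceil> < x + 1" for x :: real by linarith
  have pos: "0 < (2 * real k + 2) * (1 - \<epsilon>)" "0 < (2 * real k + 3) * (1 - \<epsilon>)" using e by auto
  consider (1) "\<epsilon> * (2 * real k + 2) < 2" "l = 2 * int k - 1"
    | (2) "2 \<le> \<epsilon> * (2 * real k + 2)" "\<epsilon> < 1 / 2" "l = \<lceil>(2 * real k + 2) * (1 - \<epsilon>)\<rceil> - 1"
    | (3) "\<epsilon> * (2 * real k + 3) < real k + 2" "l = int k"
    | (4) "\<epsilon> * (2 * real k + 3) \<ge> real k + 2" "l = \<lceil>(2 * real k + 3) * (1 - \<epsilon>)\<rceil> - 1"
    unfolding l_def sparse_f_def A by (cases "\<epsilon> * (2 * real k + 2) < 2"; cases "\<epsilon> < 1 / 2";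
      cases "\<epsilon> * (2 * real k + 3) < real k + 2") (simp_all add: not_less)
  then have "0 \<le> l \<and> l < 2 * int k \<and> real_of_int l < (2 * real k + 3) * (1 - \<epsilon>)
    \<and> (int k < l \<longrightarrow> real_of_int l < (2 * real k + 2) * (1 - \<epsilon>))"
  proof cases
    case 1
    then show ?thesis using k e by (auto simp: algebra_simps)
  next
    case 2
    have "\<lceil>(2 * real k + 2) * (1 - \<epsilon>)\<rceil> \<le> 2 * int k"
      unfolding ceiling_le_iff using 2 by (simp add: algebra_simps)
    moreover have "0 < \<lceil>(2 * real k + 2) * (1 - \<epsilon>)\<rceil>" using pos by simp
    moreover have "(2 * real k + 2) * (1 - \<epsilon>) \<le> (2 * real k + 3) * (1 - \<epsilon>)"
      using e by (intro mult_right_mono) auto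
    ultimately show ?thesis using 2(3) c[of "(2 * real k + 2) * (1 - \<epsilon>)"] by auto
  next
    case 3
    then show ?thesis using k e by (auto simp: algebra_simps)
  next
    case 4
    have "\<lceil>(2 * real k + 3) * (1 - \<epsilon>)\<rceil> \<le> int k + 1"
      unfolding ceiling_le_iff using 4 by (simp add: algebra_simps)
    moreover have "0 < \<lceil>(2 * real k + 3) * (1 - \<epsilon>)\<rceil>" using pos by simp
    ultimately show ?thesis using 4(2) k c[of "(2 * real k + 3) * (1 - \<epsilon>)"] by auto
  qed
  then show "0 \<le> l" "l < 2 * int k" "real_of_int l < (2 * real k + 3) * (1 - \<epsilon>)"
    "int k < l \<Longrightarrow> real_of_int l < (2 * real k + 2) * (1 - \<epsilon>)" by auto
qed

section \<open>The rank condition for sparse graphs\<close>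

text \<open>The bounds on \<open>l\<close> are those of \<open>sparse_f_bounds\<close>, and
  \<open>card_le\<close> is sparsity for subgraphs without isolated vertices. Below,
  \<open>fm\<close> is the graphic matroid and \<open>cm\<close> the one of
  \<open>(k, -l)\<close>-sparse sets.\<close>

locale sparse_edges =
  fixes E :: "'a set set" and k :: nat and l :: int and \<epsilon> :: real
  assumes finite_E: "finite E" and card_edge: "e \<in> E \<Longrightarrow> card e = 2"
    and k_pos: "0 < k" and l_nonneg: "0 \<le> l" and l_less: "l < 2 * int k"
    and eps_less: "\<epsilon> < 1"
    and l_less_3: "real_of_int l < (2 * real k + 3) * (1 - \<epsilon>)"
    and l_less_2: "int k < l \<Longrightarrow> real_of_int l < (2 * real k + 2) * (1 - \<epsilon>)"
    and card_le: "X \<subseteq> E \<Longrightarrow> X \<noteq> {} \<Longrightarrow> real (card X) \<le> (real k + \<epsilon>) * real (card (\<Union>X))"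
begin

sublocale fm: intersecting_submodular E "count_bound 1 1"
  by (rule count_bound_submodular) (auto simp: finite_E card_edge)

sublocale cm: intersecting_submodular E "count_bound (int k) l"
  by (rule count_bound_submodular) (auto simp: finite_E card_edge l_less)

lemma finite_Union_edges: "X \<subseteq> E \<Longrightarrow> finite (\<Union>X)"
  using finite_E card_edge card.infinite finite_subset
  by (metis finite_Union subsetD zero_neq_numeral)

lemma two_le_card_Union:
  assumes "X \<subseteq> E" "X \<noteq> {}" shows "2 \<le> card (\<Union>X)"
proof -
  obtain e where "e \<in> X" using assms by blast
  then show ?thesis
    using card_mono[OF finite_Union_edges[OF assms(1)] Union_upper] card_edge[of e] assms(1) by fastforce
qed

lemma sum_excess:
  assumes \<Q>: "finite \<Q>" "disjoint \<Q>" "\<Q> \<noteq> {}"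
    and Q: "\<And>Q. Q \<in> \<Q> \<Longrightarrow> Q \<noteq> {} \<and> Q \<subseteq> E \<and> count_bound (int k) l Q < int (card Q)"
  shows "(\<Sum>Q\<in>\<Q>. int (card Q) - count_bound (int k) l Q) \<le> int (card (\<Union>(\<Union>\<Q>))) - 1"
proof -
  define v where "v Q = int (card (\<Union>Q))" for Q :: "'a set set"
  define V where "V = int (card (\<Union>(\<Union>\<Q>)))"
  define t where "t = int (card \<Q>)"
  \<comment> \<open>Blocks are edge-disjoint but may share vertices; \<open>s\<close> counts the
    repetitions.\<close>
  define s where "s = (\<Sum>Q\<in>\<Q>. v Q) - V"
  have UE: "\<Union>\<Q> \<subseteq> E" "\<Union>\<Q> \<noteq> {}" using Q \<Q>(3) by auto
  have cb: "count_bound (int k) l Q = int k * v Q - l" for Q by (simp add: count_bound_def v_def)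
  have block: "2 \<le> v Q" "2 * int (card Q) \<le> v Q * (v Q - 1)"
    "1 \<le> int (card Q) - int k * v Q + l"
    "real (card Q) \<le> (real k + \<epsilon>) * real_of_int (v Q)" if "Q \<in> \<Q>" for Q
  proof -
    have Q': "Q \<noteq> {}" "Q \<subseteq> E" using Q[OF that] by auto
    show "2 \<le> v Q" using two_le_card_Union[OF Q'(2,1)] by (simp add: v_def)
    show "2 * int (card Q) \<le> v Q * (v Q - 1)"
      unfolding v_def using Q' finite_E card_edge finite_Union_edges[OF Q'(2)]
      by (intro card_edges_le) (auto intro: finite_subset)
    show "1 \<le> int (card Q) - int k * v Q + l" using Q[OF that] by (simp add: cb)
    show "real (card Q) \<le> (real k + \<epsilon>) * real_of_int (v Q)"
      using card_le[OF Q'(2,1)] by (simp add: v_def)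
  qed
  have vQ: "2 * int k \<le> v Q" if "Q \<in> \<Q>" for Q
    by (rule excess_vertices[OF l_less block(1-3)[OF that]])
  have tpos: "0 < t" using \<Q> by (simp add: t_def card_gt_0_iff)
  show ?thesis
  proof (cases "s < t")
    case True
    have "int (card Q) - int k * v Q + l \<le> v Q - 1" if "Q \<in> \<Q>" for Q
      using excess_le_vertices[of l "int k" "v Q" "int (card Q)" \<epsilon>] block[OF that]
        l_less eps_less l_less_3 l_less_2 by simp
    then have "(\<Sum>Q\<in>\<Q>. int (card Q) - count_bound (int k) l Q) \<le> (\<Sum>Q\<in>\<Q>. v Q - 1)"
      by (intro sum_mono) (simp add: cb algebra_simps)
    also have "\<dots> = V + s - t" by (simp add: sum_subtractf s_def t_def)
    finally show ?thesis using True by (simp add: V_def)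
  next
    case False
    \<comment> \<open>Here the block bounds would only add up to \<open>V + s - t \<ge> V\<close>,
      so sparsity is applied once, to \<open>\<Union>\<Q>\<close>, and the overlap pays for
      \<open>t * l\<close>.\<close>
    have "(\<Sum>Q\<in>\<Q>. 2 * int k) \<le> (\<Sum>Q\<in>\<Q>. v Q)" by (intro sum_mono vQ)
    then have vs: "2 * int k * t \<le> V + s" by (simp add: s_def t_def mult.commute)
    have V2: "2 \<le> V" using two_le_card_Union[OF UE] by (simp add: V_def)
    have "real_of_int t * real_of_int l < (1 - \<epsilon>) * real_of_int V + real k * real_of_int s"
    proof (rule overlap_bound)
      show "2 * real k * real_of_int t \<le> real_of_int V + real_of_int s"
        using iffD2[OF of_int_le_iff[where ?'a = real] vs] by simp
      show "2 \<le> real k" if "real k < real_of_int l"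
      proof -
        have "int k < l" using that by linarith
        then show ?thesis using l_less by linarith
      qed
      show "real_of_int l \<le> 2 * real k - 1" using l_less by linarith
      show "real_of_int l < (2 * real k + 2) * (1 - \<epsilon>)" if "real k < real_of_int l"
      proof -
        have "int k < l" using that by linarith
        then show ?thesis by (rule l_less_2)
      qed
    qed (use False V2 tpos k_pos l_nonneg eps_less in auto)
    moreover have "card (\<Union>\<Q>) = (\<Sum>Q\<in>\<Q>. card Q)"
      using \<Q>(2) Q by (intro card_Union_disjoint) (auto intro: fm.finite_subset_ground)
    then have eq: "(\<Sum>Q\<in>\<Q>. int (card Q) - count_bound (int k) l Q)
        = int (card (\<Union>\<Q>)) - int k * (V + s) + t * l"
      by (simp add: cb sum_subtractf s_def t_def flip: sum_distrib_left)
    moreover have "real (card (\<Union>\<Q>)) \<le> (real k + \<epsilon>) * real_of_int V"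
      using card_le[OF UE] by (simp add: V_def)
    ultimately have "real_of_int (int (card (\<Union>\<Q>)) - int k * (V + s) + t * l) < real_of_int V"
      by (simp add: algebra_simps)
    then have "(\<Sum>Q\<in>\<Q>. int (card Q) - count_bound (int k) l Q) < V"
      unfolding eq by (simp only: of_int_less_iff)
    then show ?thesis by (simp add: V_def)
  qed
qed

text \<open>A maximal subtree of \<open>X\<close> covers all its vertices, since connectivity would
  otherwise supply an edge with exactly one end in the tree. Trees are encoded as independent sets
  with one vertex more than edges.\<close>

lemma rank_forest_connected:
  assumes X: "X \<subseteq> E" "X \<noteq> {}"
    and conn: "\<And>A B. A \<union> B = X \<Longrightarrow> A \<noteq> {} \<Longrightarrow> B \<noteq> {} \<Longrightarrow> \<Union>A \<inter> \<Union>B \<noteq> {}"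
  shows "int (card (\<Union>X)) - 1 \<le> int (fm.rank X)"
proof -
  define \<T> where "\<T> = {T. T \<subseteq> X \<and> T \<noteq> {} \<and> fm.indep T \<and> card (\<Union>T) = card T + 1}"
  have "finite \<T>" using fm.finite_subset_ground[OF X(1)] by (auto simp: \<T>_def)
  moreover obtain e0 where e0: "e0 \<in> X" using X by blast
  have "{e0} \<in> \<T>"
    using e0 X card_edge[of e0]
    by (auto simp: \<T>_def fm.indep_def count_bound_def subset_singleton_iff)
  ultimately obtain T where T: "T \<in> \<T>" and Tmax: "\<forall>S\<in>\<T>. T \<subseteq> S \<longrightarrow> T = S"
    using finite_has_maximal[of \<T>] by blast
  have T': "T \<subseteq> X" "T \<noteq> {}" "fm.indep T" "card (\<Union>T) = card T + 1" "T \<subseteq> E"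
    using T X by (auto simp: \<T>_def)
  have "\<Union>X \<subseteq> \<Union>T"
  proof (rule ccontr)
    assume "\<not> \<Union>X \<subseteq> \<Union>T"
    \<comment> \<open>The edges inside \<open>\<Union>T\<close> and the others split
      \<open>X\<close>, so some edge of the second kind touches the tree.\<close>
    then have "{e \<in> X. \<not> e \<subseteq> \<Union>T} \<noteq> {}" by blast
    moreover have "{e \<in> X. e \<subseteq> \<Union>T} \<noteq> {}" using T' by blast
    ultimately have "\<Union>{e \<in> X. e \<subseteq> \<Union>T} \<inter> \<Union>{e \<in> X. \<not> e \<subseteq> \<Union>T} \<noteq> {}"
      by (intro conn) auto
    then obtain e u w where e: "e \<in> X" "u \<in> e" "u \<in> \<Union>T" "w \<in> e" "w \<notin> \<Union>T" by blast
    have "card e = 2" using card_edge e X by blast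
    moreover have "u \<noteq> w" using e by blast
    ultimately have euw: "e = {u, w}"
      using e(2,4) by (auto simp: card_2_iff)
    have fT: "finite (\<Union>T)" "finite T"
      using finite_Union_edges[OF T'(5)] fm.finite_subset_ground[OF T'(5)] by auto
    have eT: "e \<notin> T" using e by blast
    have "fm.indep (insert e T)"
      unfolding fm.indep_def
    proof (intro conjI allI impI)
      show "insert e T \<subseteq> E" using e X T' by blast
      fix Y assume Y: "Y \<subseteq> insert e T" "Y \<noteq> {}"
      show "int (card Y) \<le> count_bound 1 1 Y"
      proof (cases "e \<in> Y")
        case False
        then show ?thesis using Y fm.indepD[OF T'(3), of Y] by blast
      next
        case True
        define Z where "Z = Y - {e}"
        have Z: "Y = insert e Z" "e \<notin> Z" "Z \<subseteq> T" using True Y by (auto simp: Z_def)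
        have fZ: "finite Z" "finite (\<Union>Z)"
          using Z(3) T'(5) finite_subset[OF Z(3) fT(2)] finite_Union_edges[of Z] by auto
        show ?thesis
        proof (cases "Z = {}")
          case True
          then show ?thesis using Z \<open>card e = 2\<close> by (simp add: count_bound_def)
        next
          case False
          have "int (card Z) \<le> count_bound 1 1 Z" using fm.indepD[OF T'(3) Z(3) False] .
          \<comment> \<open>The new vertex \<open>w\<close> pays for the new edge
            \<open>e\<close>.\<close>
          moreover have "card (insert w (\<Union>Z)) \<le> card (\<Union>Y)"
            using Z(1) fZ euw by (intro card_mono) auto
          moreover have "w \<notin> \<Union>Z" using e Z by blast
          ultimately show ?thesis using Z(1,2) fZ by (simp add: count_bound_def)
        qed
      qed
    qed
    moreover have "\<Union>(insert e T) = insert w (\<Union>T)" using e(3) euw by auto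
    ultimately have "insert e T \<in> \<T>"
      using T'(1,4) e(1,5) eT fT by (simp add: \<T>_def)
    then show False using Tmax eT by blast
  qed
  then have "card (\<Union>X) \<le> card (\<Union>T)" using T' finite_Union_edges by (intro card_mono) auto
  then show ?thesis using T' fm.indep_card_le_rank[OF T'(3,1) X(1)] by simp
qed

text \<open>The deficiency \<open>card X - cm.rank X\<close> is the sum of the block excesses; the
  positive ones are bounded by \<open>sum_excess\<close>, and a spanning tree makes up for that many
  edges.\<close>

lemma card_le_rank_connected:
  assumes X: "X \<subseteq> E" "X \<noteq> {}"
    and conn: "\<And>A B. A \<union> B = X \<Longrightarrow> A \<noteq> {} \<Longrightarrow> B \<noteq> {} \<Longrightarrow> \<Union>A \<inter> \<Union>B \<noteq> {}"
  shows "card X \<le> fm.rank X + cm.rank X"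
proof -
  obtain \<Q> where Q: "finite \<Q>" "disjoint \<Q>" "\<forall>Q\<in>\<Q>. Q \<noteq> {} \<and> Q \<subseteq> X"
    "int (cm.rank X) = int (card (X - \<Union>\<Q>)) + (\<Sum>Q\<in>\<Q>. count_bound (int k) l Q)"
    using cm.rank_blocks[OF X(1)] by blast
  define \<D> where "\<D> = {Q \<in> \<Q>. count_bound (int k) l Q < int (card Q)}"
  have "int (card X) = int (card (X - \<Union>\<Q>)) + (\<Sum>Q\<in>\<Q>. int (card (X \<inter> Q)))"
    using card_eq_blocks[OF cm.finite_subset_ground[OF X(1)] Q(1,2)] by simp
  also have "(\<Sum>Q\<in>\<Q>. int (card (X \<inter> Q))) = (\<Sum>Q\<in>\<Q>. int (card Q))"
    using Q(3) by (intro sum.cong) (auto simp: Int_absorb1)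
  finally have "int (card X) - int (cm.rank X) = (\<Sum>Q\<in>\<Q>. int (card Q) - count_bound (int k) l Q)"
    using Q(4) by (simp add: sum_subtractf)
  also have "\<dots> \<le> (\<Sum>Q\<in>\<Q>. if count_bound (int k) l Q < int (card Q)
      then int (card Q) - count_bound (int k) l Q else 0)"
    by (intro sum_mono) auto
  also have "\<dots> = (\<Sum>Q\<in>\<D>. int (card Q) - count_bound (int k) l Q)"
    using Q(1) by (simp add: \<D>_def sum.inter_filter)
  also have "\<dots> \<le> int (card (\<Union>X)) - 1"
  proof (cases "\<D> = {}")
    case True
    then show ?thesis using two_le_card_Union[OF X] by simp
  next
    case False
    have "(\<Sum>Q\<in>\<D>. int (card Q) - count_bound (int k) l Q) \<le> int (card (\<Union>(\<Union>\<D>))) - 1"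
    proof (rule sum_excess)
      show "finite \<D>" "\<D> \<noteq> {}" using Q(1) False by (simp_all add: \<D>_def)
      show "disjoint \<D>" using Q(2) by (simp add: \<D>_def disjoint_def)
      show "Q \<noteq> {} \<and> Q \<subseteq> E \<and> count_bound (int k) l Q < int (card Q)" if "Q \<in> \<D>" for Q
        using that Q(3) X(1) by (auto simp: \<D>_def)
    qed
    moreover have "card (\<Union>(\<Union>\<D>)) \<le> card (\<Union>X)"
      using Q(3) finite_Union_edges[OF X(1)] by (intro card_mono) (auto simp: \<D>_def)
    ultimately show ?thesis by simp
  qed
  also have "\<dots> \<le> int (fm.rank X)" by (rule rank_forest_connected[OF X conn])
  finally show ?thesis by simp
qed

end

text \<open>As \<open>l \<ge> 0\<close>, the bound on a vertex-disjoint union is at least the sum of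
  the two bounds, so a union of independent sets is independent. This reduces the rank condition to
  connected edge sets.\<close>

lemma rank_superadditive:
  assumes M: "intersecting_submodular E (count_bound c l)" and l: "0 \<le> l"
    and AB: "A \<union> B \<subseteq> E" "\<Union>A \<inter> \<Union>B = {}" "A \<inter> B = {}" and fin: "finite (\<Union>(A \<union> B))"
  shows "intersecting_submodular.rank E (count_bound c l) A +
      intersecting_submodular.rank E (count_bound c l) B
    \<le> intersecting_submodular.rank E (count_bound c l) (A \<union> B)"
proof -
  interpret intersecting_submodular E "count_bound c l" by (rule M)
  obtain I where I: "I \<subseteq> A" "indep I" "card I = rank A" using rank_witness[of A] AB by blast
  obtain J where J: "J \<subseteq> B" "indep J" "card J = rank B" using rank_witness[of B] AB by blast
  have finIJ: "finite I" "finite J" using I J AB finite_subset_ground by auto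
  have "indep (I \<union> J)"
    unfolding indep_def
  proof (intro conjI allI impI)
    show "I \<union> J \<subseteq> E" using I J AB by blast
    fix Y assume Y: "Y \<subseteq> I \<union> J" "Y \<noteq> {}"
    show "int (card Y) \<le> count_bound c l Y"
    \<comment> \<open>Adding the bounds requires both parts to be nonempty: the bound
      \<open>- l\<close> of the empty set may be negative.\<close>
    proof (cases "Y \<inter> I = {} \<or> Y \<inter> J = {}")
      case True
      then have "Y \<subseteq> I \<or> Y \<subseteq> J" using Y by blast
      then show ?thesis using indepD I J Y by blast
    next
      case False
      have YU: "Y = (Y \<inter> I) \<union> (Y \<inter> J)" using Y by blast
      have "card Y \<le> card (Y \<inter> I) + card (Y \<inter> J)" using YU card_Un_le by metis
      moreover have "int (card (Y \<inter> I)) \<le> count_bound c l (Y \<inter> I)"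
        "int (card (Y \<inter> J)) \<le> count_bound c l (Y \<inter> J)"
        using False by (blast intro: indepD[OF I(2)] indepD[OF J(2)])+
      moreover have "card (\<Union>Y) = card (\<Union>(Y \<inter> I)) + card (\<Union>(Y \<inter> J))"
      proof -
        have "\<Union>Y = \<Union>(Y \<inter> I) \<union> \<Union>(Y \<inter> J)" using YU by blast
        moreover have "\<Union>(Y \<inter> I) \<inter> \<Union>(Y \<inter> J) = {}" using AB I J by blast
        moreover have "finite (\<Union>(Y \<inter> I))" "finite (\<Union>(Y \<inter> J))"
          using I J by (auto intro!: finite_subset[OF _ fin])
        ultimately show ?thesis by (simp add: card_Un_disjoint)
      qed
      ultimately show ?thesis using l by (simp add: count_bound_def algebra_simps)
    qed
  qed
  moreover have "card (I \<union> J) = card I + card J" using I J AB finIJ by (intro card_Un_disjoint) auto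
  ultimately show ?thesis using indep_card_le_rank[of "I \<union> J" "A \<union> B"] I J AB by auto
qed

context sparse_edges
begin

lemma card_le_rank: "X \<subseteq> E \<Longrightarrow> card X \<le> fm.rank X + cm.rank X"
proof (induction "card X" arbitrary: X rule: less_induct)
  case less
  note X = less.prems
  have finX: "finite X" by (rule fm.finite_subset_ground[OF X])
  show ?case
  proof (cases "X = {} \<or> (\<forall>A B. A \<union> B = X \<longrightarrow> A \<noteq> {} \<longrightarrow> B \<noteq> {} \<longrightarrow> \<Union>A \<inter> \<Union>B \<noteq> {})")
    case True
    show ?thesis
    proof (cases "X = {}")
      case False
      with True show ?thesis by (intro card_le_rank_connected[OF X]) simp_all
    qed simp
  next
    case False
    then obtain A B where AB: "A \<union> B = X" "A \<noteq> {}" "B \<noteq> {}" "\<Union>A \<inter> \<Union>B = {}" by auto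
    \<comment> \<open>Vertex-disjoint parts are edge-disjoint because no edge is empty.\<close>
    have "{} \<notin> X" using X card_edge[of "{}"] by auto
    have dis: "A \<inter> B = {}"
    proof (rule ccontr)
      assume "A \<inter> B \<noteq> {}"
      then obtain e where e: "e \<in> A" "e \<in> B" by blast
      then have "e \<subseteq> \<Union>A \<inter> \<Union>B" by blast
      with AB(4) have "e = {}" by simp
      with e(1) AB(1) \<open>{} \<notin> X\<close> show False by blast
    qed
    have c: "card X = card A + card B" using AB dis finX by (auto intro: card_Un_disjoint)
    moreover have "0 < card A" "0 < card B" using AB finX by (auto simp: card_gt_0_iff)
    ultimately have "card A \<le> fm.rank A + cm.rank A" "card B \<le> fm.rank B + cm.rank B"
      using less.hyps[of A] less.hyps[of B] AB X by auto
    moreover have "fm.rank A + fm.rank B \<le> fm.rank X"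
      using rank_superadditive[OF fm.intersecting_submodular_axioms, of A B]
        AB X dis finite_Union_edges[OF X] by simp
    moreover have "cm.rank A + cm.rank B \<le> cm.rank X"
      using rank_superadditive[OF cm.intersecting_submodular_axioms l_nonneg, of A B]
        AB X dis finite_Union_edges[OF X] by simp
    ultimately show ?thesis using c by linarith
  qed
qed

theorem forest_partition:
  "\<exists>A B. A \<union> B = E \<and> A \<inter> B = {} \<and> fm.indep A \<and> cm.indep B"
  by (rule matroid_partition[OF fm.intersecting_submodular_axioms
        cm.intersecting_submodular_axioms card_le_rank])

end

section \<open>Cycles and the return to graphs\<close>

text \<open>If the edges at positions \<open>i \<noteq> j\<close> coincided, each position would be
  the cyclic successor of the other, and the length would be two.\<close>

lemma cycle_edges_inj:
  assumes "distinct p" "3 \<le> length p"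
  shows "inj_on (\<lambda>i. {p ! i, p ! (Suc i mod length p)}) {..<length p}"
proof (rule inj_onI)
  fix i j assume ij: "i \<in> {..<length p}" "j \<in> {..<length p}"
    and eq: "{p ! i, p ! (Suc i mod length p)} = {p ! j, p ! (Suc j mod length p)}"
  have "0 < length p" using assms(2) by linarith
  then have m: "Suc i mod length p < length p" "Suc j mod length p < length p"
    by (auto intro: mod_less_divisor)
  show "i = j"
  proof (rule ccontr)
    assume "i \<noteq> j"
    then have "p ! i = p ! (Suc j mod length p)" "p ! j = p ! (Suc i mod length p)"
      using eq ij assms(1) by (auto simp: doubleton_eq_iff nth_eq_iff_index_eq)
    then have "i = Suc j mod length p" "j = Suc i mod length p"
      using assms(1) ij m by (auto simp: nth_eq_iff_index_eq)
    moreover have "Suc a mod length p = (if Suc a = length p then 0 else Suc a)" if "a < length p" for a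
      using that by simp
    ultimately show False using assms(2) ij by (auto split: if_splits)
  qed
qed

text \<open>A cycle has as many edges as vertices, one more than the bound allows.\<close>

lemma no_cycle_if_count_indep:
  assumes "\<And>Y. Y \<subseteq> uedges G \<Longrightarrow> Y \<noteq> {} \<Longrightarrow> int (card Y) \<le> count_bound 1 1 Y"
  shows "\<not> is_cycle G p"
proof
  assume c: "is_cycle G p"
  define g where "g i = {p ! i, p ! (Suc i mod length p)}" for i
  let ?Y = "g ` {..<length p}"
  have p: "distinct p" "3 \<le> length p" using c by (auto simp: is_cycle_def)
  have "card ?Y = length p"
    using cycle_edges_inj[OF p] by (simp add: g_def card_image)
  moreover have "?Y \<subseteq> uedges G" using c by (auto simp: is_cycle_def g_def)
  moreover have "?Y \<noteq> {}" using p(2) by (cases p) auto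
  moreover have "card (\<Union>?Y) \<le> length p"
  proof -
    have "g i \<subseteq> set p" if "i < length p" for i
    proof -
      have "Suc i mod length p < length p" using that by (intro mod_less_divisor) linarith
      with that show ?thesis by (simp add: g_def)
    qed
    then have "\<Union>?Y \<subseteq> set p" by blast
    then have "card (\<Union>?Y) \<le> card (set p)" by (rule card_mono[OF finite_set])
    also have "\<dots> \<le> length p" by (rule card_length)
    finally show ?thesis .
  qed
  ultimately show False using assms[of ?Y] by (simp add: count_bound_def)
qed

theorem theorem7:
  fixes k :: nat and \<epsilon> :: real and G :: "'a ugraph"
  assumes "k > 0" and "0 \<le> \<epsilon>" and "\<epsilon> < 1"
    and "finite_simple_graph G"
    and "sparse (real k + \<epsilon>) 0 G"
  shows "\<exists>F G'. usubgraph F G \<and> usubgraph G' G \<and>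
           uedges F \<union> uedges G' = uedges G \<and> uedges F \<inter> uedges G' = {} \<and>
           forest F \<and> sparse (real k) (1 - real_of_int (sparse_f k \<epsilon>)) G'"
proof -
  let ?E = "uedges G" and ?l = "sparse_f k \<epsilon> - 1"
  have finV: "finite (uverts G)" and edge: "\<And>e. e \<in> ?E \<Longrightarrow> e \<subseteq> uverts G \<and> card e = 2"
    using assms(4) by (auto simp: finite_simple_graph_def)
  have finE: "finite ?E" using edge finV by (intro finite_subset[of ?E "Pow (uverts G)"]) auto
  interpret sparse_edges ?E k ?l \<epsilon>
  proof
    fix X assume X: "X \<subseteq> ?E" "X \<noteq> {}"
    have V: "\<Union>X \<subseteq> uverts G" using X(1) edge by blast
    have "usubgraph (\<Union>X, X) G"
      using X(1) edge V finite_subset[OF V finV] by (auto simp: usubgraph_def finite_simple_graph_def)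
    then show "real (card X) \<le> (real k + \<epsilon>) * real (card (\<Union>X))"
      using assms(5)[unfolded sparse_def, rule_format, of "(\<Union>X, X)"] X(2) by simp
  qed (use finE edge assms sparse_f_bounds[OF assms(1-3)] in auto)
  obtain A B where AB: "A \<union> B = ?E" "A \<inter> B = {}" "fm.indep A" "cm.indep B"
    using forest_partition by blast
  let ?F = "(uverts G, A)" and ?G' = "(uverts G, B)"
  have sub: "usubgraph ?F G" "usubgraph ?G' G"
    using AB edge finV by (auto simp: usubgraph_def finite_simple_graph_def)
  have "forest ?F"
    using sub no_cycle_if_count_indep[of ?F] fm.indepD[OF AB(3)] by (auto simp: forest_def usubgraph_def)
  moreover have "sparse (real k) (1 - real_of_int (sparse_f k \<epsilon>)) ?G'"
    unfolding sparse_def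
  proof (intro allI impI)
    fix H assume H: "usubgraph H ?G' \<and> uedges H \<noteq> {}"
    then have "int (card (uedges H)) \<le> int k * int (card (\<Union>(uedges H))) - ?l"
      using cm.indepD[OF AB(4), of "uedges H"] by (auto simp: usubgraph_def count_bound_def)
    \<comment> \<open>\<open>H\<close> may have isolated vertices, which only weaken the
      bound.\<close>
    also have "\<dots> \<le> int k * int (card (uverts H)) - ?l"
      using H by (intro diff_right_mono mult_left_mono)
        (auto simp: usubgraph_def finite_simple_graph_def intro!: card_mono)
    finally have "real_of_int (int (card (uedges H))) \<le> real_of_int (int k * int (card (uverts H)) - ?l)"
      by (simp only: of_int_le_iff)
    then show "real (card (uedges H)) \<le> real k * real (card (uverts H)) + (1 - real_of_int (sparse_f k \<epsilon>))"
      by simp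
  qed
  ultimately show ?thesis using AB sub by (intro exI[of _ ?F] exI[of _ ?G']) simp
qed

end
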